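(* Let $t>0$, let $i_1<\dots<i_M$ be real, let $\underline b=(b_2,\dots,b_{M-1})$ satisfy $-\frac{1}{i_{j+1}-i_j}<b_j<\frac{1}{i_j-i_{j-1}}$ for $j=2,\dots,M-1$, and let $\underline k=(k_2,\dots,k_{M-1})\in\mathbb R_+^{M-2}$. For a given $\underline p\in\mathbb S^M$ there exists $(\mathcal G_1,\dots,\mathcal G_M)\in\{0\}\times\mathbb R_+^{M-2}\times\{0\}$ satisfying $$\mathcal G_j=\frac{1}{tp_j}\frac{\kappa_{j+1}-\kappa_{j-1}}{(\kappa_{j+1}-\kappa_j)(\kappa_j-\kappa_{j-1})}\times\begin{cases}\sum_{a=1}^{j-1}(\kappa_j-\kappa_a)p_a(1+t\mathcal G_a\widetilde k_a)&2\le j\le l-1\\ \sum_{a=j+1}^{M}(\kappa_a-\kappa_j)p_a(1+t\mathcal G_a\widetilde k_a)&l\le j\le M-1\end{cases}$$ for $2\le j\le M-1$, where $l\in\{2,\dots,M\}$ is such that $$\kappa_{l-1}<\frac{\sum_{j=1}^M\kappa_jp_j(1+t\mathcal G_j\widetilde k_j)}{\sum_{j=1}^Mp_j(1+t\mathcal G_j\widetilde k_j)}\le\kappa_l .$$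
   Context: Conventions: $\mathbb R_+=[0,\infty)$, $M\ge3$, $\mathbb S^M=\{(p_1,\dots,p_M):0<p_j<1,\ \sum_jp_j=1\}$. Set $\widetilde k_j=(i_{j+1}-i_j)(i_j-i_{j-1})k_j$ for $2\le j\le M-1$, $\widetilde k_1=\widetilde k_M=0$. Coordinate change $\underline\kappa=(\kappa_1,\dots,\kappa_M)$: let $\delta_j=i_j-i_{j-1}$ ($2\le j\le M$); $\Pi_1=1$, $\Pi_j=\prod_{n=2}^j\frac{1-\delta_nb_n}{1+\delta_{n+1}b_n}$ ($2\le j\le M-1$). Fix $\vartheta\in(0,\frac12)$ with $e_-:=\inf\{j:\sum_{i=1}^jp_i\ge\vartheta\}<e_+:=\sup\{j:\sum_{i=j}^Mp_i\ge\vartheta\}$, let $K=(i_{e_+}-i_{e_-})\vee1$, $\epsilon_{j+1}=K\,\delta_{j+1}\Pi_j\big/\sum_{a=e_-}^{e_+-1}\delta_{a+1}\Pi_a$ ($1\le j\le M-1$). Let $e$ satisfy $\sum_{i\le e}p_i\ge\frac12$, $\sum_{i\ge e}p_i\ge\frac12$. Then $\underline\kappa$ is defined by $\kappa_e=0$ and $\kappa_j-\kappa_{j-1}=\epsilon_j$ for $2\le j\le M$; in particular it is strictly increasing. *)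

theory Defs
  imports Complex_Main
begin

(* Vectors with entries numbered 1, ..., M are functions on nat; values at indices outside the
   stated range are irrelevant. *)

definition open_simplex :: "nat \<Rightarrow> (nat \<Rightarrow> real) set" where
  "open_simplex M = {p. (\<forall>j\<in>{1..M}. 0 < p j \<and> p j < 1) \<and> (\<Sum>j=1..M. p j) = 1}"

definition ktilde :: "nat \<Rightarrow> (nat \<Rightarrow> real) \<Rightarrow> (nat \<Rightarrow> real) \<Rightarrow> nat \<Rightarrow> real" where
  "ktilde M i k j =
    (if 2 \<le> j \<and> j \<le> M - 1 then (i (j + 1) - i j) * (i j - i (j - 1)) * k j else 0)"

definition delta :: "(nat \<Rightarrow> real) \<Rightarrow> nat \<Rightarrow> real" where
  "delta i j = i j - i (j - 1)"

definition Pi_coeff :: "(nat \<Rightarrow> real) \<Rightarrow> (nat \<Rightarrow> real) \<Rightarrow> nat \<Rightarrow> real" where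
  "Pi_coeff i b j = (\<Prod>n=2..j. (1 - delta i n * b n) / (1 + delta i (n + 1) * b n))"

(* Lower and upper theta-quantile indices. The sets are finite subsets of nat, and nonempty when
   p is in the open simplex and theta <= 1, so Inf and Sup are minimum and maximum. *)

definition e_minus :: "nat \<Rightarrow> (nat \<Rightarrow> real) \<Rightarrow> real \<Rightarrow> nat" where
  "e_minus M p \<theta> = Inf {j \<in> {1..M}. (\<Sum>n=1..j. p n) \<ge> \<theta>}"

definition e_plus :: "nat \<Rightarrow> (nat \<Rightarrow> real) \<Rightarrow> real \<Rightarrow> nat" where
  "e_plus M p \<theta> = Sup {j \<in> {1..M}. (\<Sum>n=j..M. p n) \<ge> \<theta>}"

definition K_const :: "nat \<Rightarrow> (nat \<Rightarrow> real) \<Rightarrow> (nat \<Rightarrow> real) \<Rightarrow> real \<Rightarrow> real" where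
  "K_const M i p \<theta> = max (i (e_plus M p \<theta>) - i (e_minus M p \<theta>)) 1"

(* Meaningful for j in {2..M}; the index is shifted by one relative to the recipe for
   epsilon_(j+1) with j in {1..M-1}. *)
definition eps_coeff ::
  "nat \<Rightarrow> (nat \<Rightarrow> real) \<Rightarrow> (nat \<Rightarrow> real) \<Rightarrow> (nat \<Rightarrow> real) \<Rightarrow> real \<Rightarrow> nat \<Rightarrow> real" where
  "eps_coeff M i b p \<theta> j =
    K_const M i p \<theta> * delta i j * Pi_coeff i b (j - 1) /
      (\<Sum>a = e_minus M p \<theta>..e_plus M p \<theta> - 1. delta i (a + 1) * Pi_coeff i b a)"

definition is_median :: "nat \<Rightarrow> (nat \<Rightarrow> real) \<Rightarrow> nat \<Rightarrow> bool" where
  "is_median M p e \<longleftrightarrow>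
    e \<in> {1..M} \<and> (\<Sum>n=1..e. p n) \<ge> 1 / 2 \<and> (\<Sum>n=e..M. p n) \<ge> 1 / 2"

(* These conditions determine kappa uniquely on {1..M}. *)
definition is_kappa ::
  "nat \<Rightarrow> (nat \<Rightarrow> real) \<Rightarrow> (nat \<Rightarrow> real) \<Rightarrow> (nat \<Rightarrow> real) \<Rightarrow> real \<Rightarrow> nat \<Rightarrow> (nat \<Rightarrow> real) \<Rightarrow> bool"
  where
  "is_kappa M i b p \<theta> e \<kappa> \<longleftrightarrow>
    \<kappa> e = 0 \<and> (\<forall>j\<in>{2..M}. \<kappa> j - \<kappa> (j - 1) = eps_coeff M i b p \<theta> j)"

end

theory Submission
  imports Defs
begin

text \<open>For a fixed \<open>l\<close> the system decouples: below \<open>l\<close> it is a forward recursion started at \<open>1\<close>,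
  from \<open>l\<close> on a backward recursion started at \<open>M\<close>, and neither solution depends on \<open>l\<close>.
  Let \<open>A j\<close> be the left moment \<open>\<Sum>a<j. (\<kappa> j - \<kappa> a) p a (1 + t G a k a)\<close> of the forward solution and
  \<open>B j\<close> the corresponding right moment of the backward solution. Gluing the two at \<open>l\<close>, the
  weighted mean of \<open>\<kappa>\<close> exceeds \<open>\<kappa> (l - 1)\<close> iff \<open>A (l - 1) < B (l - 1)\<close>, and is at most \<open>\<kappa> l\<close>
  iff \<open>B l \<le> A l\<close>. As \<open>A 1 < B 1\<close> and \<open>B M \<le> A M\<close>, the least \<open>l\<close> with \<open>B l \<le> A l\<close> works.\<close>

fun forward_solution ::
  "(nat \<Rightarrow> real) \<Rightarrow> (nat \<Rightarrow> real) \<Rightarrow> (nat \<Rightarrow> real) \<Rightarrow> real \<Rightarrow> (nat \<Rightarrow> real) \<Rightarrow> nat \<Rightarrow> real"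
where
  "forward_solution c \<kappa> p t s j =
    c j * (\<Sum>a\<in>{1..<j}. (\<kappa> j - \<kappa> a) * p a * (1 + t * forward_solution c \<kappa> p t s a * s a))"

function backward_solution ::
  "nat \<Rightarrow> (nat \<Rightarrow> real) \<Rightarrow> (nat \<Rightarrow> real) \<Rightarrow> (nat \<Rightarrow> real) \<Rightarrow> real \<Rightarrow> (nat \<Rightarrow> real) \<Rightarrow> nat \<Rightarrow> real"
where
  "backward_solution M c \<kappa> p t s j =
    c j * (\<Sum>a\<in>{j<..M}. (\<kappa> a - \<kappa> j) * p a * (1 + t * backward_solution M c \<kappa> p t s a * s a))"
  by pat_completeness auto
termination
  by (relation "measure (\<lambda>(M, _, _, _, _, _, j). M - j)") auto

declare forward_solution.simps [simp del] backward_solution.simps [simp del]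

lemma forward_solution_nonneg:
  assumes "strict_mono_on {1..M} \<kappa>" "t \<ge> 0"
    and "\<And>j. j \<in> {1..M} \<Longrightarrow> c j \<ge> 0" "\<And>j. j \<in> {1..M} \<Longrightarrow> p j \<ge> 0"
    and "\<And>j. j \<in> {1..M} \<Longrightarrow> s j \<ge> 0"
    and "j \<in> {1..M}"
  shows "forward_solution c \<kappa> p t s j \<ge> 0"
  using \<open>j \<in> {1..M}\<close>
proof (induction j rule: less_induct)
  case (less j)
  have "0 \<le> (\<kappa> j - \<kappa> a) * p a * (1 + t * forward_solution c \<kappa> p t s a * s a)"
    if "a \<in> {1..<j}" for a
    using that less assms strict_mono_onD[OF assms(1), of a j] by fastforce
  then show ?case
    by (subst forward_solution.simps) (use less.prems assms in \<open>intro mult_nonneg_nonneg[OF _ sum_nonneg]; blast\<close>)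
qed

lemma backward_solution_nonneg:
  assumes "strict_mono_on {1..M} \<kappa>" "t \<ge> 0"
    and "\<And>j. j \<in> {1..M} \<Longrightarrow> c j \<ge> 0" "\<And>j. j \<in> {1..M} \<Longrightarrow> p j \<ge> 0"
    and "\<And>j. j \<in> {1..M} \<Longrightarrow> s j \<ge> 0"
    and "j \<in> {1..M}"
  shows "backward_solution M c \<kappa> p t s j \<ge> 0"
  using \<open>j \<in> {1..M}\<close>
proof (induction j rule: measure_induct_rule[where f = "\<lambda>j. M - j"])
  case (less j)
  have "0 \<le> (\<kappa> a - \<kappa> j) * p a * (1 + t * backward_solution M c \<kappa> p t s a * s a)"
    if "a \<in> {j<..M}" for a
  proof -
    have "backward_solution M c \<kappa> p t s a \<ge> 0"
      using less that by auto
    then show ?thesis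
      using that less.prems assms strict_mono_onD[OF assms(1), of j a] by fastforce
  qed
  then show ?case
    by (subst backward_solution.simps) (use less.prems assms in \<open>intro mult_nonneg_nonneg[OF _ sum_nonneg]; blast\<close>)
qed

lemma sum_diff_split:
  fixes \<kappa> w :: "nat \<Rightarrow> real"
  assumes "m \<in> {1..M}"
  shows "(\<Sum>j=1..M. \<kappa> j * w j) - \<kappa> m * (\<Sum>j=1..M. w j) =
    (\<Sum>a\<in>{m<..M}. (\<kappa> a - \<kappa> m) * w a) - (\<Sum>a\<in>{1..<m}. (\<kappa> m - \<kappa> a) * w a)"
proof -
  have "{1..M} = {1..<m} \<union> ({m} \<union> {m<..M})"
    using assms by auto
  then have "(\<Sum>a=1..M. (\<kappa> a - \<kappa> m) * w a) =
      (\<Sum>a\<in>{1..<m}. (\<kappa> a - \<kappa> m) * w a) + (\<Sum>a\<in>{m<..M}. (\<kappa> a - \<kappa> m) * w a)"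
    by (simp add: sum.union_disjoint disjoint_iff)
  also have "(\<Sum>a\<in>{1..<m}. (\<kappa> a - \<kappa> m) * w a) = - (\<Sum>a\<in>{1..<m}. (\<kappa> m - \<kappa> a) * w a)"
    by (simp flip: sum_negf) (simp add: algebra_simps)
  finally show ?thesis
    by (simp add: left_diff_distrib sum_subtractf sum_distrib_left)
qed

lemma glued_recursion_exists:
  fixes \<kappa> p c s :: "nat \<Rightarrow> real"
  assumes M: "M \<ge> 2" and mono: "strict_mono_on {1..M} \<kappa>" and t: "t \<ge> 0"
    and c: "\<And>j. j \<in> {1..M} \<Longrightarrow> c j \<ge> 0" and p: "\<And>j. j \<in> {1..M} \<Longrightarrow> p j > 0"
    and s: "\<And>j. j \<in> {1..M} \<Longrightarrow> s j \<ge> 0"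
  obtains G l where "\<And>j. j \<in> {1..M} \<Longrightarrow> G j \<ge> 0" "l \<in> {2..M}"
    "\<kappa> (l - 1) < (\<Sum>j=1..M. \<kappa> j * p j * (1 + t * G j * s j)) / (\<Sum>j=1..M. p j * (1 + t * G j * s j))"
    "(\<Sum>j=1..M. \<kappa> j * p j * (1 + t * G j * s j)) / (\<Sum>j=1..M. p j * (1 + t * G j * s j)) \<le> \<kappa> l"
    "\<And>j. j \<in> {1..M} \<Longrightarrow> G j = c j *
      (if j \<le> l - 1 then (\<Sum>a=1..j-1. (\<kappa> j - \<kappa> a) * p a * (1 + t * G a * s a))
       else (\<Sum>a=j+1..M. (\<kappa> a - \<kappa> j) * p a * (1 + t * G a * s a)))"
proof -
  define L where "L = forward_solution c \<kappa> p t s"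
  define U where "U = backward_solution M c \<kappa> p t s"
  define A where "A m = (\<Sum>a\<in>{1..<m}. (\<kappa> m - \<kappa> a) * (p a * (1 + t * L a * s a)))" for m
  define B where "B m = (\<Sum>a\<in>{m<..M}. (\<kappa> a - \<kappa> m) * (p a * (1 + t * U a * s a)))" for m
  have Leq: "L j = c j * A j" for j
    unfolding L_def A_def by (subst forward_solution.simps) (simp add: mult.assoc)
  have Ueq: "U j = c j * B j" for j
    unfolding U_def B_def by (subst backward_solution.simps) (simp add: mult.assoc)
  have L0: "L j \<ge> 0" and U0: "U j \<ge> 0" if "j \<in> {1..M}" for j
    using forward_solution_nonneg[OF mono t c _ s that] backward_solution_nonneg[OF mono t c _ s that] p
    by (auto simp: L_def U_def less_imp_le)
  have pos: "p a * (1 + t * x * s a) > 0" if "a \<in> {1..M}" "x \<ge> 0" for a x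
    using that p[of a] s[of a] t by (auto intro!: mult_pos_pos add_pos_nonneg)
  have AM: "A M \<ge> 0"
    unfolding A_def
    using M by (intro sum_nonneg mult_nonneg_nonneg[OF _ less_imp_le[OF pos]])
      (auto intro!: L0 less_imp_le[OF strict_mono_onD[OF mono]])
  have "B 1 > 0"
    unfolding B_def
    using M by (intro sum_pos mult_pos_pos[OF _ pos]) (auto intro!: U0 strict_mono_onD[OF mono])
  moreover have "A 1 = 0" "B M = 0"
    by (auto simp: A_def B_def)
  ultimately have bdry: "A 1 < B 1" "B M \<le> A M"
    using AM by auto
  define l where "l = (LEAST l. 1 \<le> l \<and> B l \<le> A l)"
  have l: "1 \<le> l \<and> B l \<le> A l"
    using LeastI[of "\<lambda>l. 1 \<le> l \<and> B l \<le> A l" M] M bdry unfolding l_def by auto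
  have "l \<le> M"
    using Least_le[of "\<lambda>l. 1 \<le> l \<and> B l \<le> A l" M] M bdry unfolding l_def by auto
  moreover have "l \<noteq> 1"
    using l bdry by auto
  ultimately have l2: "l \<in> {2..M}"
    using l by auto
  have l1: "A (l - 1) < B (l - 1)"
    using not_less_Least[of "l - 1" "\<lambda>l. 1 \<le> l \<and> B l \<le> A l"] l2 unfolding l_def[symmetric] by auto
  define G where "G j = (if j < l then L j else U j)" for j
  define w where "w j = p j * (1 + t * G j * s j)" for j
  have G0: "G j \<ge> 0" if "j \<in> {1..M}" for j
    using that L0 U0 by (simp add: G_def)
  have wpos: "(\<Sum>j=1..M. w j) > 0"
    unfolding w_def using M pos G0 by (intro sum_pos) auto
  have Aw: "A m = (\<Sum>a\<in>{1..<m}. (\<kappa> m - \<kappa> a) * w a)" if "m \<le> l" for m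
    unfolding A_def w_def using that by (intro sum.cong) (auto simp: G_def)
  have Bw: "B m = (\<Sum>a\<in>{m<..M}. (\<kappa> a - \<kappa> m) * w a)" if "l \<le> m + 1" for m
    unfolding B_def w_def using that by (intro sum.cong) (auto simp: G_def)
  have split: "(\<Sum>j=1..M. \<kappa> j * w j) - \<kappa> m * (\<Sum>j=1..M. w j) = B m - A m"
    if "m \<in> {l - 1, l}" for m
    using that l2 by (subst sum_diff_split) (auto simp: Aw Bw)
  have mean: "(\<Sum>j=1..M. \<kappa> j * p j * (1 + t * G j * s j)) / (\<Sum>j=1..M. p j * (1 + t * G j * s j)) =
      (\<Sum>j=1..M. \<kappa> j * w j) / (\<Sum>j=1..M. w j)"
    by (simp add: w_def mult.assoc)
  show thesis
  proof
    show "l \<in> {2..M}" by fact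
    show "G j \<ge> 0" if "j \<in> {1..M}" for j
      using G0 that .
    show "\<kappa> (l - 1) < (\<Sum>j=1..M. \<kappa> j * p j * (1 + t * G j * s j)) / (\<Sum>j=1..M. p j * (1 + t * G j * s j))"
      unfolding mean using split[of "l - 1"] l1 wpos by (simp add: pos_less_divide_eq)
    show "(\<Sum>j=1..M. \<kappa> j * p j * (1 + t * G j * s j)) / (\<Sum>j=1..M. p j * (1 + t * G j * s j)) \<le> \<kappa> l"
      unfolding mean using split[of l] l wpos by (simp add: pos_divide_le_eq)
    show "G j = c j *
      (if j \<le> l - 1 then (\<Sum>a=1..j-1. (\<kappa> j - \<kappa> a) * p a * (1 + t * G a * s a))
       else (\<Sum>a=j+1..M. (\<kappa> a - \<kappa> j) * p a * (1 + t * G a * s a)))" if "j \<in> {1..M}" for j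
    proof (cases "j < l")
      case True
      then have "G j = c j * (\<Sum>a\<in>{1..<j}. (\<kappa> j - \<kappa> a) * w a)"
        by (simp add: G_def Leq Aw)
      moreover have "{1..<j} = {1..j-1}" by auto
      ultimately show ?thesis
        using True by (simp add: w_def mult.assoc)
    next
      case False
      then have "G j = c j * (\<Sum>a\<in>{j<..M}. (\<kappa> a - \<kappa> j) * w a)"
        by (simp add: G_def Ueq Bw)
      moreover have "{j<..M} = {j+1..M}" "\<not> j \<le> l - 1"
        using False l2 by auto
      ultimately show ?thesis
        by (simp add: w_def mult.assoc)
    qed
  qed
qed

lemma strict_mono_on_atLeastAtMostI:
  fixes f :: "nat \<Rightarrow> 'a::order"
  assumes "\<And>j. m \<le> j \<Longrightarrow> j < n \<Longrightarrow> f j < f (Suc j)"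
  shows "strict_mono_on {m..n} f"
proof (rule strict_mono_onI)
  fix r s assume "r \<in> {m..n}" "s \<in> {m..n}" "r < s"
  then have "Suc r \<le> s" "m \<le> r" "s \<le> n" by auto
  then show "f r < f s"
  proof (induction s rule: dec_induct)
    case base
    then show ?case using assms by simp
  next
    case (step s)
    then show ?case using assms[of s] by (auto intro: less_trans)
  qed
qed

lemma Pi_coeff_pos:
  assumes i: "strict_mono_on {1..M} i"
    and b: "\<forall>j\<in>{2..M-1}. - (1 / (i (j + 1) - i j)) < b j \<and> b j < 1 / (i j - i (j - 1))"
    and "j \<le> M - 1"
  shows "Pi_coeff i b j > 0"
  unfolding Pi_coeff_def
proof (intro prod_pos divide_pos_pos ballI)
  fix n assume "n \<in> {2..j}"
  then have n: "n \<in> {2..M-1}" using assms by auto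
  then have "i (n - 1) < i n" "i n < i (n + 1)"
    by (auto intro!: strict_mono_onD[OF i])
  then show "0 < 1 - delta i n * b n" "0 < 1 + delta i (n + 1) * b n"
    using b[rule_format, OF n] by (auto simp: delta_def field_simps)
qed

lemma e_minus_ge_1:
  assumes "p \<in> open_simplex M" "M \<ge> 1" "\<theta> \<le> 1"
  shows "e_minus M p \<theta> \<ge> 1"
proof -
  have "M \<in> {j \<in> {1..M}. (\<Sum>n=1..j. p n) \<ge> \<theta>}"
    using assms by (auto simp: open_simplex_def)
  then have "e_minus M p \<theta> \<in> {j \<in> {1..M}. (\<Sum>n=1..j. p n) \<ge> \<theta>}"
    unfolding e_minus_def by (intro Inf_nat_def1) blast
  then show ?thesis by auto
qed

lemma e_plus_le:
  assumes "p \<in> open_simplex M" "M \<ge> 1" "\<theta> \<le> 1"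
  shows "e_plus M p \<theta> \<le> M"
proof -
  have "1 \<in> {j \<in> {1..M}. (\<Sum>n=j..M. p n) \<ge> \<theta>}"
    using assms by (auto simp: open_simplex_def)
  then show ?thesis
    unfolding e_plus_def by (intro cSup_least) auto
qed

lemma eps_coeff_pos:
  assumes i: "strict_mono_on {1..M} i"
    and b: "\<forall>j\<in>{2..M-1}. - (1 / (i (j + 1) - i j)) < b j \<and> b j < 1 / (i j - i (j - 1))"
    and p: "p \<in> open_simplex M" and \<theta>: "\<theta> \<le> 1" "e_minus M p \<theta> < e_plus M p \<theta>"
    and j: "j \<in> {2..M}"
  shows "eps_coeff M i b p \<theta> j > 0"
proof -
  have d: "delta i n > 0" if "n \<in> {2..M}" for n
    using that by (auto simp: delta_def intro!: strict_mono_onD[OF i])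
  have "1 \<le> e_minus M p \<theta>" "e_plus M p \<theta> \<le> M"
    using e_minus_ge_1 e_plus_le p \<theta> j by auto
  then have "(\<Sum>a = e_minus M p \<theta>..e_plus M p \<theta> - 1. delta i (a + 1) * Pi_coeff i b a) > 0"
    using \<theta> by (intro sum_pos mult_pos_pos d Pi_coeff_pos[OF i b]) auto
  moreover have "K_const M i p \<theta> > 0"
    by (simp add: K_const_def)
  moreover have "Pi_coeff i b (j - 1) > 0"
    using j by (intro Pi_coeff_pos[OF i b]) auto
  ultimately show ?thesis
    using d j by (simp add: eps_coeff_def)
qed

theorem lemma4p1:
  fixes M e :: nat and t \<theta> :: real and i b k p \<kappa> :: "nat \<Rightarrow> real"
  assumes "M \<ge> 3"
    and "t > 0"
    and "strict_mono_on {1..M} i"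
    and "\<forall>j\<in>{2..M-1}. - (1 / (i (j + 1) - i j)) < b j \<and> b j < 1 / (i j - i (j - 1))"
    and "\<forall>j\<in>{2..M-1}. k j \<ge> 0"
    and "p \<in> open_simplex M"
    and "0 < \<theta>" and "\<theta> < 1 / 2"
    and "e_minus M p \<theta> < e_plus M p \<theta>"
    and "is_median M p e"
    and "is_kappa M i b p \<theta> e \<kappa>"
  shows "\<exists>G :: nat \<Rightarrow> real.
    G 1 = 0 \<and> G M = 0 \<and> (\<forall>j\<in>{2..M-1}. G j \<ge> 0) \<and>
    (\<exists>l\<in>{2..M}.
      \<kappa> (l - 1) < (\<Sum>j=1..M. \<kappa> j * p j * (1 + t * G j * ktilde M i k j)) /
                   (\<Sum>j=1..M. p j * (1 + t * G j * ktilde M i k j)) \<and>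
      (\<Sum>j=1..M. \<kappa> j * p j * (1 + t * G j * ktilde M i k j)) /
        (\<Sum>j=1..M. p j * (1 + t * G j * ktilde M i k j)) \<le> \<kappa> l \<and>
      (\<forall>j\<in>{2..M-1}.
        G j = 1 / (t * p j) *
              ((\<kappa> (j + 1) - \<kappa> (j - 1)) / ((\<kappa> (j + 1) - \<kappa> j) * (\<kappa> j - \<kappa> (j - 1)))) *
              (if j \<le> l - 1
               then (\<Sum>a=1..j-1. (\<kappa> j - \<kappa> a) * p a * (1 + t * G a * ktilde M i k a))
               else (\<Sum>a=j+1..M. (\<kappa> a - \<kappa> j) * p a * (1 + t * G a * ktilde M i k a)))))"
proof -
  have mono: "strict_mono_on {1..M} \<kappa>"
  proof (rule strict_mono_on_atLeastAtMostI)
    fix j assume "1 \<le> j" "j < M"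
    then have "\<kappa> (Suc j) - \<kappa> j = eps_coeff M i b p \<theta> (Suc j)"
      using \<open>is_kappa M i b p \<theta> e \<kappa>\<close> by (auto simp: is_kappa_def dest!: bspec[of _ _ "Suc j"])
    moreover have "eps_coeff M i b p \<theta> (Suc j) > 0"
      using assms \<open>1 \<le> j\<close> \<open>j < M\<close> by (intro eps_coeff_pos) auto
    ultimately show "\<kappa> j < \<kappa> (Suc j)" by simp
  qed
  define c where "c j = (if j \<in> {2..M-1} then 1 / (t * p j) *
    ((\<kappa> (j + 1) - \<kappa> (j - 1)) / ((\<kappa> (j + 1) - \<kappa> j) * (\<kappa> j - \<kappa> (j - 1)))) else 0)" for j
  have p: "p j > 0" if "j \<in> {1..M}" for j
    using \<open>p \<in> open_simplex M\<close> that by (auto simp: open_simplex_def)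
  have c: "c j \<ge> 0" for j
  proof (cases "j \<in> {2..M-1}")
    case True
    then have "\<kappa> (j - 1) < \<kappa> j" "\<kappa> j < \<kappa> (j + 1)" "p j > 0"
      by (auto intro!: strict_mono_onD[OF mono] p)
    then show ?thesis
      using \<open>t > 0\<close> by (simp add: c_def)
  qed (auto simp: c_def)
  have s: "ktilde M i k j \<ge> 0" for j
  proof (cases "j \<in> {2..M-1}")
    case True
    then have "i (j - 1) < i j" "i j < i (j + 1)"
      by (auto intro!: strict_mono_onD[OF \<open>strict_mono_on {1..M} i\<close>])
    then show ?thesis
      using assms(5) True by (simp add: ktilde_def)
  qed (auto simp: ktilde_def)
  have c_end: "c 1 = 0" "c M = 0"
    using \<open>M \<ge> 3\<close> by (auto simp: c_def)
  show ?thesis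
  proof (rule glued_recursion_exists[of M \<kappa> t c p "ktilde M i k"])
    show "2 \<le> M" "strict_mono_on {1..M} \<kappa>" "0 \<le> t"
      using assms mono by auto
    show "0 \<le> c j" "0 \<le> ktilde M i k j" for j
      by (fact c, fact s)
    show "0 < p j" if "j \<in> {1..M}" for j
      using p that .
  next
    fix G l
    assume G0: "\<And>j. j \<in> {1..M} \<Longrightarrow> G j \<ge> 0" and l: "l \<in> {2..M}"
      and mean: "\<kappa> (l - 1) < (\<Sum>j=1..M. \<kappa> j * p j * (1 + t * G j * ktilde M i k j)) /
          (\<Sum>j=1..M. p j * (1 + t * G j * ktilde M i k j))"
        "(\<Sum>j=1..M. \<kappa> j * p j * (1 + t * G j * ktilde M i k j)) /
          (\<Sum>j=1..M. p j * (1 + t * G j * ktilde M i k j)) \<le> \<kappa> l"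
      and G: "\<And>j. j \<in> {1..M} \<Longrightarrow> G j = c j *
        (if j \<le> l - 1 then (\<Sum>a=1..j-1. (\<kappa> j - \<kappa> a) * p a * (1 + t * G a * ktilde M i k a))
         else (\<Sum>a=j+1..M. (\<kappa> a - \<kappa> j) * p a * (1 + t * G a * ktilde M i k a)))"
    have "G 1 = 0" "G M = 0"
      using G[of 1] G[of M] c_end \<open>M \<ge> 3\<close> by auto
    moreover have "\<forall>j\<in>{2..M-1}. G j \<ge> 0"
      using G0 by auto
    moreover have "\<forall>j\<in>{2..M-1}. G j = 1 / (t * p j) *
        ((\<kappa> (j + 1) - \<kappa> (j - 1)) / ((\<kappa> (j + 1) - \<kappa> j) * (\<kappa> j - \<kappa> (j - 1)))) *
        (if j \<le> l - 1
         then (\<Sum>a=1..j-1. (\<kappa> j - \<kappa> a) * p a * (1 + t * G a * ktilde M i k a))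
         else (\<Sum>a=j+1..M. (\<kappa> a - \<kappa> j) * p a * (1 + t * G a * ktilde M i k a)))"
      (is "\<forall>j\<in>_. ?P j")
    proof
      fix j assume "j \<in> {2..M-1}"
      then have "j \<in> {1..M}" "c j = 1 / (t * p j) *
          ((\<kappa> (j + 1) - \<kappa> (j - 1)) / ((\<kappa> (j + 1) - \<kappa> j) * (\<kappa> j - \<kappa> (j - 1))))"
        by (auto simp: c_def)
      then show "?P j"
        using G[of j] by (simp only:)
    qed
    ultimately show ?thesis
      using l mean by blast
  qed
qed

end
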